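(* Let $S$ and $T$ be disjoint non-empty finite sets. Let $H_0=(S,T;F_0)$ be a simple bipartite graph and let $G_0$ be its bipartite complement. Let $M_S=(S,r_S)$ be a matroid on $S$, let $p_T$ be an integer-valued fully supermodular set-function on $T$, and let $m_V=(m_S,m_T)$ be a degree-specification (non-negative integers) on $S\cup T$ with $\widetilde m_S(S)=\widetilde m_T(T)=\gamma$. Then there exists a bipartite graph $G=(S,T;E)$ fitting $m_V$ for which $G^+=G+H_0$ is simple and $M_S$-covers $p_T$ if and only if both $$\widetilde m_S(X)+\widetilde m_T(Y)-d_{G_0}(X,Y)\le\gamma\quad\text{for all } X\subseteq S,\ Y\subseteq T,$$ and $$\widetilde m_S(X)+\widetilde m_T(Y)-d_{G_0}(X,Y)+p_T(T_0)-r_S(X\cup\Gamma_{H_0}(T_0))\le\gamma\quad\text{for all } X\subseteq S,\ Y\subseteq T,\ T_0\subseteq T-Y.$$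
   Context: A bipartite graph (bigraph) $G=(S,T;E)$ has all edges between $S$ and $T$; parallel edges are a priori allowed, and $G$ is simple if it has none. The bipartite complement of a simple bigraph $H_0=(S,T;F_0)$ is $G_0=(S,T;E_0)$ where $E_0$ consists of all pairs $st$ ($s\in S,t\in T$) not in $F_0$; $G+H_0$ denotes the bigraph with edge set $E\cup F_0$. $d_{G_0}(X,Y)$ is the number of edges of $G_0$ joining $X\subseteq S$ and $Y\subseteq T$. $\Gamma_H(Y)$ is the set of neighbours in $S$ of $Y\subseteq T$ in the bigraph $H$. $\widetilde m(Z)=\sum_{v\in Z}m(v)$. $G$ fits $m_V$ if $d_G(v)=m_V(v)$ for all $v\in S\cup T$. A set-function $p$ on $T$ is fully supermodular if $p(A)+p(B)\le p(A\cap B)+p(A\cup B)$ for all $A,B\subseteq T$. $G$ $M_S$-covers $p_T$ if $r_S(\Gamma_G(Y))\ge p_T(Y)$ for every $Y\subseteq T$, where $r_S$ is the rank function of $M_S$. *)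

theory Defs
  imports Complex_Main "HOL-Library.Multiset"
begin

text \<open>
  A bigraph with classes S and T is given by the multiset of its edges, an edge joining
  s in S and t in T being the pair (s, t); multiplicities count parallel edges.
\<close>

type_synonym 'a edges = "('a \<times> 'a) multiset"

definition bigraph :: "'a set \<Rightarrow> 'a set \<Rightarrow> 'a edges \<Rightarrow> bool" where
  "bigraph S T E \<longleftrightarrow> set_mset E \<subseteq> S \<times> T"

definition simple :: "'a edges \<Rightarrow> bool" where
  "simple E \<longleftrightarrow> (\<forall>e. count E e \<le> 1)"

definition bip_complement :: "'a set \<Rightarrow> 'a set \<Rightarrow> 'a edges \<Rightarrow> 'a edges" where
  "bip_complement S T F = mset_set (S \<times> T - set_mset F)"

definition edges_between :: "'a edges \<Rightarrow> 'a set \<Rightarrow> 'a set \<Rightarrow> nat" where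
  "edges_between E X Y = size {# e \<in># E. fst e \<in> X \<and> snd e \<in> Y #}"

definition degree :: "'a edges \<Rightarrow> 'a \<Rightarrow> nat" where
  "degree E v = size {# e \<in># E. fst e = v \<or> snd e = v #}"

definition neighbours :: "'a edges \<Rightarrow> 'a set \<Rightarrow> 'a set" where
  "neighbours E Y = {s. \<exists>t\<in>Y. (s, t) \<in># E}"

definition fits :: "'a set \<Rightarrow> 'a set \<Rightarrow> 'a edges \<Rightarrow> ('a \<Rightarrow> nat) \<Rightarrow> ('a \<Rightarrow> nat) \<Rightarrow> bool" where
  "fits S T E m\<^sub>S m\<^sub>T \<longleftrightarrow> (\<forall>s\<in>S. degree E s = m\<^sub>S s) \<and> (\<forall>t\<in>T. degree E t = m\<^sub>T t)"

text \<open>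
  The matroid (S, r) is given by its rank function r, subject to the usual rank axioms;
  the values of r outside the subsets of S are irrelevant.
\<close>

definition matroid :: "'a set \<Rightarrow> ('a set \<Rightarrow> nat) \<Rightarrow> bool" where
  "matroid S r \<longleftrightarrow> finite S
     \<and> (\<forall>X. X \<subseteq> S \<longrightarrow> r X \<le> card X)
     \<and> (\<forall>X Y. X \<subseteq> Y \<longrightarrow> Y \<subseteq> S \<longrightarrow> r X \<le> r Y)
     \<and> (\<forall>X Y. X \<subseteq> S \<longrightarrow> Y \<subseteq> S \<longrightarrow> r (X \<inter> Y) + r (X \<union> Y) \<le> r X + r Y)"

definition fully_supermodular :: "'a set \<Rightarrow> ('a set \<Rightarrow> int) \<Rightarrow> bool" where
  "fully_supermodular T p \<longleftrightarrow>
     (\<forall>A B. A \<subseteq> T \<longrightarrow> B \<subseteq> T \<longrightarrow> p A + p B \<le> p (A \<inter> B) + p (A \<union> B))"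

definition matroid_covers :: "('a set \<Rightarrow> nat) \<Rightarrow> 'a set \<Rightarrow> 'a edges \<Rightarrow> ('a set \<Rightarrow> int) \<Rightarrow> bool" where
  "matroid_covers r T E p \<longleftrightarrow> (\<forall>Y. Y \<subseteq> T \<longrightarrow> int (r (neighbours E Y)) \<ge> p Y)"

end

theory Submission imports Defs
begin

text \<open>
  Let \<open>h(X,Y) = \<gamma> - m\<^sub>S(X) - m\<^sub>T(Y) + d(X,Y)\<close>, with \<open>d\<close> counted in \<open>G\<^sub>0\<close>. For a graph \<open>G\<close> as required,
  \<open>h(X,Y)\<close> counts the edges of \<open>G\<close> that avoid both \<open>X\<close> and \<open>Y\<close> and the edges of \<open>G\<^sub>0\<close> between \<open>X\<close> and
  \<open>Y\<close> that are not in \<open>G\<close>; as \<open>T\<^sub>0\<close> is disjoint from \<open>Y\<close>, the former supply all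
  the neighbours that \<open>T\<^sub>0\<close> gains in \<open>G\<close> outside \<open>X \<union> \<Gamma>(T\<^sub>0)\<close>, whence necessity.

  Sufficiency goes by induction on \<open>\<gamma>\<close>: moving an edge \<open>st\<close> from \<open>G\<^sub>0\<close> to \<open>H\<^sub>0\<close> and lowering \<open>m\<^sub>S(s)\<close>,
  \<open>m\<^sub>T(t)\<close> and \<open>\<gamma>\<close> by one decreases \<open>h(X,Y)\<close>, by one, exactly when \<open>s \<notin> X\<close> and \<open>t \<notin> Y\<close>. So \<open>st\<close> is
  blocked only by tight pairs (\<open>h(X,Y) = 0\<close>) and tight triples (\<open>h(X,Y) = p(T\<^sub>0) - r(X \<union> \<Gamma>(T\<^sub>0))\<close>)
  with \<open>s \<notin> X\<close>. Fix \<open>s\<close> with \<open>m\<^sub>S(s) > 0\<close>. The sets \<open>Y\<close> of the tight pairs, and of the tight triples for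
  which \<open>s\<close> is in the closure of \<open>X \<union> \<Gamma>(T\<^sub>0)\<close>, have to contain \<open>t\<close>; by uncrossing they are closed
  under intersection. The vertex \<open>t\<close> is found in the smallest of them and, if some tight triple with
  \<open>s \<notin> X\<close> has a set \<open>Y\<close> not including it, in a minimal \<open>T\<^sub>0\<close> of such a triple.
\<close>

section \<open>Matroid rank\<close>

lemma matroid_finite: "matroid S r \<Longrightarrow> finite S"
  unfolding matroid_def by blast

lemma matroid_rank_mono: "matroid S r \<Longrightarrow> X \<subseteq> Y \<Longrightarrow> Y \<subseteq> S \<Longrightarrow> r X \<le> r Y"
  unfolding matroid_def by blast

lemma matroid_rank_submodular:
  "matroid S r \<Longrightarrow> X \<subseteq> S \<Longrightarrow> Y \<subseteq> S \<Longrightarrow> r (X \<inter> Y) + r (X \<union> Y) \<le> r X + r Y"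
  unfolding matroid_def by blast

lemma matroid_rank_Un_le:
  assumes "matroid S r" "X \<subseteq> S" "Z \<subseteq> S"
  shows "r (X \<union> Z) \<le> r X + card Z"
proof -
  have "r Z \<le> card Z"
    using assms unfolding matroid_def by blast
  then show ?thesis
    using matroid_rank_submodular[OF assms] by linarith
qed

definition spans :: "('a set \<Rightarrow> nat) \<Rightarrow> 'a set \<Rightarrow> 'a \<Rightarrow> bool" where
  "spans r A s \<longleftrightarrow> r (insert s A) = r A"

lemma spans_member: "s \<in> A \<Longrightarrow> spans r A s"
  unfolding spans_def by (simp add: insert_absorb)

lemma spans_mono:
  assumes "matroid S r" "spans r A s" "A \<subseteq> B" "B \<subseteq> S" "s \<in> S"
  shows "spans r B s"
proof -
  have "r (insert s A \<inter> B) + r (insert s A \<union> B) \<le> r (insert s A) + r B"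
    using assms by (intro matroid_rank_submodular[OF assms(1)]) auto
  moreover have "insert s A \<union> B = insert s B"
    using assms by auto
  moreover have "r A \<le> r (insert s A \<inter> B)" "r B \<le> r (insert s B)"
    using assms by (auto intro!: matroid_rank_mono[OF assms(1)])
  ultimately show ?thesis
    using assms(2) unfolding spans_def by auto
qed

section \<open>The slack function\<close>

definition slack ::
    "('a \<times> 'b) set \<Rightarrow> ('a \<Rightarrow> nat) \<Rightarrow> ('b \<Rightarrow> nat) \<Rightarrow> nat \<Rightarrow> 'a set \<Rightarrow> 'b set \<Rightarrow> int" where
  "slack F mS mT g X Y =
     int g - int (\<Sum>s\<in>X. mS s) - int (\<Sum>t\<in>Y. mT t) + int (card (X \<times> Y - F))"

lemma card_rectangle_uncross:
  assumes "finite X" "finite Y" "finite X'" "finite Y'"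
  shows "card (X \<times> Y - F) + card (X' \<times> Y' - F) =
    card ((X \<inter> X') \<times> (Y \<union> Y') - F) + card ((X \<union> X') \<times> (Y \<inter> Y') - F)
    + card ((X - X') \<times> (Y - Y') - F) + card ((X' - X) \<times> (Y' - Y) - F)"
proof -
  let ?U = "(X \<union> X') \<times> (Y \<union> Y') - F"
  have card_eq: "card (A \<times> B - F) = (\<Sum>(a, b)\<in>?U. of_bool (a \<in> A \<and> b \<in> B))"
    if "A \<subseteq> X \<union> X'" "B \<subseteq> Y \<union> Y'" for A B
  proof -
    have "?U \<inter> {e. fst e \<in> A \<and> snd e \<in> B} = A \<times> B - F"
      using that by auto
    then show ?thesis
      using assms by (simp add: case_prod_unfold)
  qed
  have "(\<Sum>(a, b)\<in>?U. of_bool (a \<in> X \<and> b \<in> Y)) + (\<Sum>(a, b)\<in>?U. of_bool (a \<in> X' \<and> b \<in> Y')) =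
    (\<Sum>(a, b)\<in>?U. of_bool (a \<in> X \<inter> X' \<and> b \<in> Y \<union> Y'))
    + (\<Sum>(a, b)\<in>?U. of_bool (a \<in> X \<union> X' \<and> b \<in> Y \<inter> Y'))
    + (\<Sum>(a, b)\<in>?U. of_bool (a \<in> X - X' \<and> b \<in> Y - Y'))
    + (\<Sum>(a, b)\<in>?U. of_bool (a \<in> X' - X \<and> b \<in> Y' - Y) :: nat)"
    unfolding sum.distrib[symmetric] by (rule sum.cong) auto
  then show ?thesis
    by (subst (1 2 3 4 5 6) card_eq) auto
qed

lemma slack_uncross:
  assumes "finite X" "finite Y" "finite X'" "finite Y'"
  shows "slack F mS mT g X Y + slack F mS mT g X' Y' =
    slack F mS mT g (X \<inter> X') (Y \<union> Y') + slack F mS mT g (X \<union> X') (Y \<inter> Y')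
    + int (card ((X - X') \<times> (Y - Y') - F)) + int (card ((X' - X) \<times> (Y' - Y) - F))"
  using card_rectangle_uncross[OF assms, of F]
    sum.union_inter[OF assms(1,3), of mS] sum.union_inter[OF assms(2,4), of mT]
  unfolding slack_def by linarith

lemma slack_insert_left:
  assumes "finite X" "finite Y" "s \<notin> X"
  shows "slack F mS mT g (insert s X) Y =
    slack F mS mT g X Y - int (mS s) + int (card ({s} \<times> Y - F))"
  using slack_uncross[of X Y "{s}" Y F mS mT g] assms by (simp add: slack_def)

lemma slack_remove_right:
  assumes "finite X" "finite Y" "t \<in> Y"
  shows "slack F mS mT g X (Y - {t}) =
    slack F mS mT g X Y + int (mT t) - int (card (X \<times> {t} - F))"
  using slack_uncross[of X "Y - {t}" X "{t}" F mS mT g] assms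
  by (simp add: slack_def insert_absorb)

definition decrement :: "'a \<Rightarrow> ('a \<Rightarrow> nat) \<Rightarrow> 'a \<Rightarrow> nat" where
  "decrement x f = f(x := f x - 1)"

lemma sum_decrement:
  assumes "finite A" "0 < f x"
  shows "sum (decrement x f) A + of_bool (x \<in> A) = sum f A"
proof (cases "x \<in> A")
  case True
  then show ?thesis
    using assms by (simp add: decrement_def sum.remove[of A x])
next
  case False
  then have "sum (decrement x f) A = sum f A"
    by (intro sum.cong) (auto simp: decrement_def)
  then show ?thesis
    using False by simp
qed

lemma slack_insert_edge:
  assumes "finite X" "finite Y" "(s, t) \<notin> F" "0 < mS s" "0 < mT t"
  shows "slack (insert (s, t) F) (decrement s mS) (decrement t mT) g X Y =
    slack F mS mT (Suc g) X Y - of_bool (s \<notin> X \<and> t \<notin> Y)"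
proof -
  have "card (X \<times> Y - F) = card (X \<times> Y - F - {(s, t)}) + of_bool ((s, t) \<in> X \<times> Y - F)"
    using assms(1,2) card.remove[of "X \<times> Y - F" "(s, t)"] by simp
  moreover have "X \<times> Y - F - {(s, t)} = X \<times> Y - insert (s, t) F"
    by blast
  ultimately have "card (X \<times> Y - F) =
      card (X \<times> Y - insert (s, t) F) + of_bool (s \<in> X \<and> t \<in> Y)"
    using assms(3) by simp
  then show ?thesis
    using sum_decrement[of X mS s, OF assms(1,4)] sum_decrement[of Y mT t, OF assms(2,5)]
    unfolding slack_def by (auto simp del: of_nat_sum split: if_splits)
qed

section \<open>Necessity\<close>

definition has_degrees ::
    "'a set \<Rightarrow> 'b set \<Rightarrow> ('a \<times> 'b) set \<Rightarrow> ('a \<Rightarrow> nat) \<Rightarrow> ('b \<Rightarrow> nat) \<Rightarrow> bool" where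
  "has_degrees S T E mS mT \<longleftrightarrow>
    (\<forall>s\<in>S. card (E `` {s}) = mS s) \<and> (\<forall>t\<in>T. card (E\<inverse> `` {t}) = mT t)"

definition realizable ::
    "'a set \<Rightarrow> 'b set \<Rightarrow> ('a set \<Rightarrow> nat) \<Rightarrow> ('b set \<Rightarrow> int) \<Rightarrow>
      ('a \<times> 'b) set \<Rightarrow> ('a \<Rightarrow> nat) \<Rightarrow> ('b \<Rightarrow> nat) \<Rightarrow> bool" where
  "realizable S T r p F mS mT \<longleftrightarrow>
    (\<exists>E. E \<subseteq> S \<times> T - F \<and> has_degrees S T E mS mT \<and> (\<forall>Y\<subseteq>T. p Y \<le> int (r ((E \<union> F)\<inverse> `` Y))))"

definition feasible ::
    "'a set \<Rightarrow> 'b set \<Rightarrow> ('a set \<Rightarrow> nat) \<Rightarrow> ('b set \<Rightarrow> int) \<Rightarrow>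
      ('a \<times> 'b) set \<Rightarrow> ('a \<Rightarrow> nat) \<Rightarrow> ('b \<Rightarrow> nat) \<Rightarrow> nat \<Rightarrow> bool" where
  "feasible S T r p F mS mT g \<longleftrightarrow>
    (\<forall>X Y. X \<subseteq> S \<longrightarrow> Y \<subseteq> T \<longrightarrow> 0 \<le> slack F mS mT g X Y) \<and>
    (\<forall>X Y T0. X \<subseteq> S \<longrightarrow> Y \<subseteq> T \<longrightarrow> T0 \<subseteq> T - Y \<longrightarrow>
       p T0 - int (r (X \<union> F\<inverse> `` T0)) \<le> slack F mS mT g X Y)"

lemma feasibleD:
  assumes "feasible S T r p F mS mT g" "X \<subseteq> S" "Y \<subseteq> T"
  shows "0 \<le> slack F mS mT g X Y"
    and "T0 \<subseteq> T - Y \<Longrightarrow> p T0 - int (r (X \<union> F\<inverse> `` T0)) \<le> slack F mS mT g X Y"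
  using assms unfolding feasible_def by blast+

lemma sum_card_Image:
  assumes "finite E" "finite X"
  shows "(\<Sum>s\<in>X. card (E `` {s})) = card (E \<inter> X \<times> UNIV)"
proof -
  have "finite (E `` {s})" for s
    using assms by simp
  then have "(\<Sum>s\<in>X. card (E `` {s})) = card (SIGMA s:X. E `` {s})"
    using assms by simp
  also have "(SIGMA s:X. E `` {s}) = E \<inter> X \<times> UNIV"
    by auto
  finally show ?thesis .
qed

lemma has_degrees_converse:
  "has_degrees T S (E\<inverse>) mT mS \<longleftrightarrow> has_degrees S T E mS mT"
  unfolding has_degrees_def by auto

lemma has_degrees_sum_left:
  assumes "has_degrees S T E mS mT" "finite E" "E \<subseteq> S \<times> T" "finite A" "A \<subseteq> S"
  shows "sum mS A = card (E \<inter> A \<times> T)"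
proof -
  have "sum mS A = (\<Sum>s\<in>A. card (E `` {s}))"
    using assms by (intro sum.cong) (auto simp: has_degrees_def)
  also have "\<dots> = card (E \<inter> A \<times> UNIV)"
    using assms by (intro sum_card_Image)
  also have "E \<inter> A \<times> UNIV = E \<inter> A \<times> T"
    using assms by auto
  finally show ?thesis .
qed

lemma has_degrees_sum_right:
  assumes "has_degrees S T E mS mT" "finite E" "E \<subseteq> S \<times> T" "finite B" "B \<subseteq> T"
  shows "sum mT B = card (E \<inter> S \<times> B)"
proof -
  have "sum mT B = card (E\<inverse> \<inter> B \<times> S)"
    using assms by (intro has_degrees_sum_left[of T S "E\<inverse>" mT mS]) (auto simp: has_degrees_converse)
  also have "E\<inverse> \<inter> B \<times> S = (E \<inter> S \<times> B)\<inverse>"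
    by auto
  finally show ?thesis
    by simp
qed

lemma slack_eq_card_edges:
  assumes "finite S" "finite T" and E: "E \<subseteq> S \<times> T - F" and degrees: "has_degrees S T E mS mT"
    and sum_mS: "sum mS S = g" and X: "X \<subseteq> S" and Y: "Y \<subseteq> T"
  shows "slack F mS mT g X Y =
    int (card (E \<inter> (S - X) \<times> (T - Y))) + int (card (X \<times> Y - F - E))"
proof -
  have E_subset: "E \<subseteq> S \<times> T"
    using E by blast
  have fin: "finite X" "finite Y" "finite E"
    using finite_subset[OF X] finite_subset[OF Y] finite_subset[OF E_subset] \<open>finite S\<close> \<open>finite T\<close> by auto
  note sum_left = has_degrees_sum_left[OF degrees fin(3) E_subset]
  have "E \<inter> S \<times> T = (E \<inter> X \<times> T \<union> E \<inter> S \<times> Y) \<union> E \<inter> (S - X) \<times> (T - Y)"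
    using X Y by auto
  then have "card (E \<inter> S \<times> T) =
      card (E \<inter> X \<times> T \<union> E \<inter> S \<times> Y) + card (E \<inter> (S - X) \<times> (T - Y))"
    using fin by (simp only:) (intro card_Un_disjoint, auto)
  moreover have "(E \<inter> X \<times> T) \<inter> (E \<inter> S \<times> Y) = E \<inter> X \<times> Y"
    using X Y by auto
  then have "card (E \<inter> X \<times> T) + card (E \<inter> S \<times> Y) =
      card (E \<inter> X \<times> T \<union> E \<inter> S \<times> Y) + card (E \<inter> X \<times> Y)"
    using card_Un_Int[of "E \<inter> X \<times> T" "E \<inter> S \<times> Y"] fin by simp
  moreover have "X \<times> Y - F = E \<inter> X \<times> Y \<union> (X \<times> Y - F - E)"
    using E by auto
  then have "card (X \<times> Y - F) = card (E \<inter> X \<times> Y) + card (X \<times> Y - F - E)"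
    using fin card_Un_disjoint[of "E \<inter> X \<times> Y" "X \<times> Y - F - E"] by fastforce
  ultimately show ?thesis
    using sum_left[OF \<open>finite S\<close> order_refl] sum_left[OF fin(1) X]
      has_degrees_sum_right[OF degrees fin(3) E_subset fin(2) Y] sum_mS
    unfolding slack_def by linarith
qed

lemma realizable_imp_feasible:
  assumes M: "matroid S r" and "finite T" and F: "F \<subseteq> S \<times> T"
    and "sum mS S = g" and "realizable S T r p F mS mT"
  shows "feasible S T r p F mS mT g"
  unfolding feasible_def
proof (intro conjI allI impI)
  fix X Y assume XY: "X \<subseteq> S" "Y \<subseteq> T"
  have "finite S"
    using matroid_finite[OF M] .
  obtain E where E: "E \<subseteq> S \<times> T - F" "has_degrees S T E mS mT"
    and cover: "\<And>Y. Y \<subseteq> T \<Longrightarrow> p Y \<le> int (r ((E \<union> F)\<inverse> `` Y))"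
    using assms unfolding realizable_def by blast
  let ?D = "E \<inter> (S - X) \<times> (T - Y)"
  have slack: "slack F mS mT g X Y = int (card ?D) + int (card (X \<times> Y - F - E))"
    using slack_eq_card_edges[OF \<open>finite S\<close> \<open>finite T\<close> E \<open>sum mS S = g\<close> XY] .
  then show "0 \<le> slack F mS mT g X Y"
    by simp
  fix T0 assume T0: "T0 \<subseteq> T - Y"
  have "finite ?D"
    using \<open>finite S\<close> \<open>finite T\<close> by (intro finite_Int) auto
  have "(E \<union> F)\<inverse> `` T0 \<subseteq> X \<union> F\<inverse> `` T0 \<union> fst ` ?D"
    using E T0 by force
  then have "r ((E \<union> F)\<inverse> `` T0) \<le> r (X \<union> F\<inverse> `` T0 \<union> fst ` ?D)"
    using F XY by (intro matroid_rank_mono[OF M]) auto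
  also have "\<dots> \<le> r (X \<union> F\<inverse> `` T0) + card (fst ` ?D)"
    using F XY by (intro matroid_rank_Un_le[OF M]) auto
  also have "card (fst ` ?D) \<le> card ?D"
    using \<open>finite ?D\<close> by (rule card_image_le)
  finally have "r ((E \<union> F)\<inverse> `` T0) \<le> r (X \<union> F\<inverse> `` T0) + card ?D"
    by simp
  moreover have "p T0 \<le> int (r ((E \<union> F)\<inverse> `` T0))"
    using T0 by (intro cover) auto
  ultimately show "p T0 - int (r (X \<union> F\<inverse> `` T0)) \<le> slack F mS mT g X Y"
    unfolding slack by linarith
qed

section \<open>Uncrossing tight sets\<close>

locale feasible_instance =
  fixes S :: "'a set" and T :: "'b set" and r :: "'a set \<Rightarrow> nat" and p :: "'b set \<Rightarrow> int"
    and F :: "('a \<times> 'b) set" and mS :: "'a \<Rightarrow> nat" and mT :: "'b \<Rightarrow> nat" and g :: nat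
  assumes matroid: "matroid S r" and finite_T: "finite T"
    and supermodular: "fully_supermodular T p" and edges: "F \<subseteq> S \<times> T"
    and feasible: "feasible S T r p F mS mT g"
begin

abbreviation h :: "'a set \<Rightarrow> 'b set \<Rightarrow> int" where
  "h \<equiv> slack F mS mT g"

abbreviation \<Gamma> :: "'b set \<Rightarrow> 'a set" where
  "\<Gamma> A \<equiv> F\<inverse> `` A"

lemma finite_left: "X \<subseteq> S \<Longrightarrow> finite X"
  using matroid_finite[OF matroid] finite_subset by blast

lemma finite_right: "Y \<subseteq> T \<Longrightarrow> finite Y"
  using finite_T finite_subset by blast

lemma \<Gamma>_subset: "\<Gamma> A \<subseteq> S"
  using edges by auto

lemmas rank_mono = matroid_rank_mono[OF matroid]

lemmas slack_nonneg = feasibleD(1)[OF feasible]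

lemmas slack_ge_deficit = feasibleD(2)[OF feasible]

lemma h_uncross:
  assumes "X \<subseteq> S" "Y \<subseteq> T" "X' \<subseteq> S" "Y' \<subseteq> T"
  shows "h X Y + h X' Y' = h (X \<inter> X') (Y \<union> Y') + h (X \<union> X') (Y \<inter> Y')
    + int (card ((X - X') \<times> (Y - Y') - F)) + int (card ((X' - X) \<times> (Y' - Y) - F))"
  using assms by (intro slack_uncross finite_left finite_right)

definition tight_pair :: "'a set \<Rightarrow> 'b set \<Rightarrow> bool" where
  "tight_pair X Y \<longleftrightarrow> X \<subseteq> S \<and> Y \<subseteq> T \<and> h X Y = 0"

definition tight_triple :: "'a set \<Rightarrow> 'b set \<Rightarrow> 'b set \<Rightarrow> bool" where
  "tight_triple X Y T0 \<longleftrightarrow>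
    X \<subseteq> S \<and> Y \<subseteq> T \<and> T0 \<subseteq> T - Y \<and> h X Y = p T0 - int (r (X \<union> \<Gamma> T0))"

lemma tight_pair_Un_Int:
  assumes "tight_pair X Y" "tight_pair X' Y'"
  shows "tight_pair (X \<union> X') (Y \<inter> Y')"
proof -
  have sub: "X \<subseteq> S" "Y \<subseteq> T" "X' \<subseteq> S" "Y' \<subseteq> T" "X \<union> X' \<subseteq> S" "Y \<inter> Y' \<subseteq> T"
    "X \<inter> X' \<subseteq> S" "Y \<union> Y' \<subseteq> T"
    using assms unfolding tight_pair_def by auto
  show ?thesis
    using h_uncross[OF sub(1-4)] slack_nonneg[OF sub(5,6)] slack_nonneg[OF sub(7,8)] assms sub
    unfolding tight_pair_def by auto
qed

lemma deficit_supermodular: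
  assumes "X \<subseteq> S" "X' \<subseteq> S" "T0 \<subseteq> T" "T0' \<subseteq> T"
  shows "(p T0 - int (r (X \<union> \<Gamma> T0))) + (p T0' - int (r (X' \<union> \<Gamma> T0')))
    \<le> (p (T0 \<inter> T0') - int (r ((X \<inter> X') \<union> \<Gamma> (T0 \<inter> T0'))))
      + (p (T0 \<union> T0') - int (r ((X \<union> X') \<union> \<Gamma> (T0 \<union> T0'))))"
proof -
  have sub: "X \<union> \<Gamma> T0 \<subseteq> S" "X' \<union> \<Gamma> T0' \<subseteq> S"
    using assms \<Gamma>_subset by auto
  have "r ((X \<union> \<Gamma> T0) \<inter> (X' \<union> \<Gamma> T0')) + r ((X \<union> \<Gamma> T0) \<union> (X' \<union> \<Gamma> T0'))
      \<le> r (X \<union> \<Gamma> T0) + r (X' \<union> \<Gamma> T0')"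
    using matroid_rank_submodular[OF matroid sub] .
  moreover have "(X \<union> \<Gamma> T0) \<union> (X' \<union> \<Gamma> T0') = (X \<union> X') \<union> \<Gamma> (T0 \<union> T0')"
    by auto
  moreover have "r ((X \<inter> X') \<union> \<Gamma> (T0 \<inter> T0')) \<le> r ((X \<union> \<Gamma> T0) \<inter> (X' \<union> \<Gamma> T0'))"
    using sub by (intro rank_mono) auto
  moreover have "p T0 + p T0' \<le> p (T0 \<inter> T0') + p (T0 \<union> T0')"
    using supermodular assms unfolding fully_supermodular_def by blast
  ultimately show ?thesis
    by auto
qed

lemma tight_triple_uncross:
  assumes "tight_triple X Y T0" "tight_triple X' Y' T0'"
  shows "tight_triple (X \<union> X') (Y \<inter> Y') (T0 \<union> T0')"
    and "tight_triple (X \<inter> X') (Y \<union> Y') (T0 \<inter> T0')"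
proof -
  have sub: "X \<subseteq> S" "Y \<subseteq> T" "X' \<subseteq> S" "Y' \<subseteq> T" "X \<union> X' \<subseteq> S" "Y \<inter> Y' \<subseteq> T"
    "T0 \<union> T0' \<subseteq> T - (Y \<inter> Y')" "X \<inter> X' \<subseteq> S" "Y \<union> Y' \<subseteq> T" "T0 \<inter> T0' \<subseteq> T - (Y \<union> Y')"
    "T0 \<subseteq> T" "T0' \<subseteq> T"
    using assms unfolding tight_triple_def by auto
  show "tight_triple (X \<union> X') (Y \<inter> Y') (T0 \<union> T0')"
    "tight_triple (X \<inter> X') (Y \<union> Y') (T0 \<inter> T0')"
    using deficit_supermodular[OF sub(1,3,11,12)] h_uncross[OF sub(1-4)]
      slack_ge_deficit[OF sub(5-7)] slack_ge_deficit[OF sub(8-10)] assms sub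
    unfolding tight_triple_def by auto
qed

text \<open>
  Here the rank may grow when \<open>X'\<close> is added to \<open>X\<close>, but a vertex \<open>t\<^sub>0 \<in> T\<^sub>0 \<inter> Y'\<close> supplies, for every
  new element \<open>x\<close>, an edge \<open>xt\<^sub>0\<close> of the surplus term in the uncrossing identity.
\<close>

lemma tight_triple_Un_pair_if_meets:
  assumes "tight_triple X Y T0" "tight_pair X' Y'" "T0 \<inter> Y' \<noteq> {}"
  shows "tight_triple (X \<union> X') (Y \<inter> Y') T0"
proof -
  obtain t0 where t0: "t0 \<in> T0" "t0 \<in> Y'"
    using assms by auto
  have sub: "X \<subseteq> S" "Y \<subseteq> T" "X' \<subseteq> S" "Y' \<subseteq> T" "X \<union> X' \<subseteq> S" "Y \<inter> Y' \<subseteq> T"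
    "T0 \<subseteq> T - (Y \<inter> Y')" "X \<inter> X' \<subseteq> S" "Y \<union> Y' \<subseteq> T" "T0 \<subseteq> T - Y"
    using assms unfolding tight_triple_def tight_pair_def by auto
  let ?Z = "X' - (X \<union> \<Gamma> T0)"
  have "card ?Z = card (?Z \<times> {t0})"
    by (simp add: card_cartesian_product)
  also have "\<dots> \<le> card ((X' - X) \<times> (Y' - Y) - F)"
    using t0 sub finite_left finite_right
    by (intro card_mono finite_Diff finite_cartesian_product) auto
  finally have "card ?Z \<le> card ((X' - X) \<times> (Y' - Y) - F)" .
  moreover have "r ((X \<union> \<Gamma> T0) \<union> ?Z) \<le> r (X \<union> \<Gamma> T0) + card ?Z"
    using sub \<Gamma>_subset by (intro matroid_rank_Un_le[OF matroid]) auto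
  moreover have "(X \<union> \<Gamma> T0) \<union> ?Z = (X \<union> X') \<union> \<Gamma> T0"
    by auto
  ultimately show ?thesis
    using h_uncross[OF sub(1-4)] slack_ge_deficit[OF sub(5-7)] slack_nonneg[OF sub(8,9)] assms sub
    unfolding tight_triple_def tight_pair_def by auto
qed

lemma tight_pair_Un_triple_if_disjoint:
  assumes "tight_triple X Y T0" "tight_pair X' Y'" "T0 \<inter> Y' = {}"
  shows "tight_pair (X \<union> X') (Y \<inter> Y')"
proof -
  have sub: "X \<subseteq> S" "Y \<subseteq> T" "X' \<subseteq> S" "Y' \<subseteq> T" "X \<union> X' \<subseteq> S" "Y \<inter> Y' \<subseteq> T"
    "X \<inter> X' \<subseteq> S" "Y \<union> Y' \<subseteq> T" "T0 \<subseteq> T - (Y \<union> Y')"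
    using assms unfolding tight_triple_def tight_pair_def by auto
  have "r ((X \<inter> X') \<union> \<Gamma> T0) \<le> r (X \<union> \<Gamma> T0)"
    using sub \<Gamma>_subset by (intro rank_mono) auto
  then show ?thesis
    using h_uncross[OF sub(1-4)] slack_nonneg[OF sub(5,6)] slack_ge_deficit[OF sub(7-9)] assms sub
    unfolding tight_triple_def tight_pair_def by auto
qed

section \<open>Finding an unblocked edge\<close>

definition spanning_triple :: "'a \<Rightarrow> 'a set \<Rightarrow> 'b set \<Rightarrow> 'b set \<Rightarrow> bool" where
  "spanning_triple s X Y T0 \<longleftrightarrow> tight_triple X Y T0 \<and> spans r (X \<union> \<Gamma> T0) s"

definition blocking :: "'a \<Rightarrow> 'b set \<Rightarrow> bool" where
  "blocking s Y \<longleftrightarrow> (\<exists>X. s \<notin> X \<and> (tight_pair X Y \<or> (\<exists>T0. spanning_triple s X Y T0)))"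

definition unblocked :: "'a \<Rightarrow> 'b \<Rightarrow> bool" where
  "unblocked s t \<longleftrightarrow>
    (\<forall>Y. blocking s Y \<longrightarrow> t \<in> Y) \<and> (\<forall>X Y T0. tight_triple X Y T0 \<longrightarrow> s \<notin> X \<longrightarrow> t \<in> Y \<union> T0)"

lemma blocking_cases:
  assumes "blocking s Y"
  obtains (pair) X where "s \<notin> X" "tight_pair X Y"
    | (triple) X T0 where "s \<notin> X" "spanning_triple s X Y T0"
  using assms unfolding blocking_def by blast

lemma blocking_subset: "blocking s Y \<Longrightarrow> Y \<subseteq> T"
  unfolding blocking_def spanning_triple_def tight_pair_def tight_triple_def by blast

lemma spanning_triple_mono:
  assumes "s \<in> S" "spanning_triple s X Y T0" "tight_triple X' Y' T0'" "X \<subseteq> X'" "T0 \<subseteq> T0'"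
  shows "spanning_triple s X' Y' T0'"
proof -
  have "X' \<union> \<Gamma> T0' \<subseteq> S"
    using assms(3) \<Gamma>_subset unfolding tight_triple_def by auto
  moreover have "X \<union> \<Gamma> T0 \<subseteq> X' \<union> \<Gamma> T0'"
    using assms by auto
  ultimately show ?thesis
    using assms spans_mono[OF matroid] unfolding spanning_triple_def by blast
qed

lemma blocking_Int_triple:
  assumes "s \<in> S" "spanning_triple s X Y T0" "s \<notin> X" "tight_triple X' Y' T0'" "s \<notin> X'"
  shows "blocking s (Y \<inter> Y')"
proof -
  have "tight_triple (X \<union> X') (Y \<inter> Y') (T0 \<union> T0')"
    using assms by (intro tight_triple_uncross) (auto simp: spanning_triple_def)
  then have "spanning_triple s (X \<union> X') (Y \<inter> Y') (T0 \<union> T0')"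
    using assms by (intro spanning_triple_mono[OF assms(1,2)]) auto
  then show ?thesis
    using assms unfolding blocking_def by blast
qed

lemma blocking_Int_pair:
  assumes "s \<in> S" "blocking s Y" "tight_pair X' Y'" "s \<notin> X'"
  shows "blocking s (Y \<inter> Y')"
  using assms(2)
proof (cases rule: blocking_cases)
  case (pair X)
  then show ?thesis
    using tight_pair_Un_Int[OF pair(2) assms(3)] assms(4) unfolding blocking_def by blast
next
  case (triple X T0)
  then have tight: "tight_triple X Y T0"
    unfolding spanning_triple_def by blast
  show ?thesis
  proof (cases "T0 \<inter> Y' = {}")
    case True
    then show ?thesis
      using tight_pair_Un_triple_if_disjoint[OF tight assms(3)] triple(1) assms(4)
      unfolding blocking_def by blast
  next
    case False
    then have "spanning_triple s (X \<union> X') (Y \<inter> Y') T0"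
      using tight_triple_Un_pair_if_meets[OF tight assms(3)]
      by (intro spanning_triple_mono[OF assms(1) triple(2)]) auto
    then show ?thesis
      using triple(1) assms(4) unfolding blocking_def by blast
  qed
qed

lemma blocking_Int:
  assumes "s \<in> S" "blocking s Y" "blocking s Y'"
  shows "blocking s (Y \<inter> Y')"
  using assms(3)
proof (cases rule: blocking_cases)
  case (pair X')
  then show ?thesis
    using blocking_Int_pair[OF assms(1,2)] by blast
next
  case triple': (triple X' T0')
  show ?thesis
    using assms(2)
  proof (cases rule: blocking_cases)
    case (pair X)
    then show ?thesis
      using blocking_Int_pair[OF assms(1,3) pair(2,1)] by (simp add: Int_commute)
  next
    case (triple X T0)
    then show ?thesis
      using blocking_Int_triple[OF assms(1)] triple' unfolding spanning_triple_def by blast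
  qed
qed

definition core :: "'a \<Rightarrow> 'b set" where
  "core s = \<Inter> {Y. blocking s Y}"

lemma core_subset: "blocking s Y \<Longrightarrow> core s \<subseteq> Y"
  unfolding core_def by blast

lemma blocking_core:
  assumes "s \<in> S" "sum mT T = g"
  shows "blocking s (core s)"
proof -
  have "tight_pair {} T"
    using assms(2) unfolding tight_pair_def slack_def by simp
  then have "blocking s T"
    unfolding blocking_def by blast
  moreover have "{Y. blocking s Y} \<subseteq> Pow T"
    using blocking_subset by blast
  then have "finite {Y. blocking s Y}"
    using finite_T finite_subset finite_Pow_iff by blast
  ultimately have "\<Inter> {Y. blocking s Y} \<in> {Y. blocking s Y}"
    using blocking_Int[OF assms(1)] by (intro finite_Inf_in) auto
  then show ?thesis
    unfolding core_def by blast
qed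

lemma blocking_slack_insert_mono:
  assumes "s \<in> S" "blocking s Y"
  obtains X where "X \<subseteq> S" "s \<notin> X" "h X Y \<le> h (insert s X) Y"
  using assms(2)
proof (cases rule: blocking_cases)
  case (pair X)
  then show thesis
    using that[of X] slack_nonneg[of "insert s X" Y] assms(1) unfolding tight_pair_def by auto
next
  case (triple X T0)
  then show thesis
    using that[of X] slack_ge_deficit[of "insert s X" Y T0] assms(1)
    unfolding spanning_triple_def tight_triple_def spans_def by auto
qed

lemma blocking_contains_nonneighbour:
  assumes "s \<in> S" "0 < mS s" "blocking s Y"
  obtains t where "t \<in> Y" "(s, t) \<notin> F"
proof -
  obtain X where X: "X \<subseteq> S" "s \<notin> X" "h X Y \<le> h (insert s X) Y"
    using blocking_slack_insert_mono[OF assms(1,3)] .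
  have "0 < card ({s} \<times> Y - F)"
    using slack_insert_left[OF finite_left[OF X(1)] finite_right[OF blocking_subset[OF assms(3)]] X(2)]
      X(3) assms(2) by fastforce
  then obtain t where "(s, t) \<in> {s} \<times> Y - F"
    by (fastforce simp: card_gt_0_iff)
  then show thesis
    using that by blast
qed

lemma blocking_remove:
  assumes "blocking s Y" "t \<in> Y" "mT t = 0"
  shows "blocking s (Y - {t})"
proof -
  have le: "h X (Y - {t}) \<le> h X Y" if "X \<subseteq> S" for X
    using slack_remove_right[of X Y t F mS mT g] that blocking_subset[OF assms(1)] assms
      finite_left finite_right by auto
  show ?thesis
    using assms(1)
  proof (cases rule: blocking_cases)
    case (pair X)
    then have "tight_pair X (Y - {t})"
      using le[of X] slack_nonneg[of X "Y - {t}"] unfolding tight_pair_def by fastforce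
    then show ?thesis
      using pair unfolding blocking_def by blast
  next
    case (triple X T0)
    then have "X \<subseteq> S" "Y - {t} \<subseteq> T" "T0 \<subseteq> T - (Y - {t})"
      unfolding spanning_triple_def tight_triple_def by auto
    then have "spanning_triple s X (Y - {t}) T0"
      using le[of X] slack_ge_deficit[of X "Y - {t}" T0] triple(2)
      unfolding spanning_triple_def tight_triple_def by auto
    then show ?thesis
      using triple(1) unfolding blocking_def by blast
  qed
qed

lemma degree_pos_on_core:
  assumes "s \<in> S" "sum mT T = g" "t \<in> core s"
  shows "0 < mT t"
  using blocking_remove[OF blocking_core[OF assms(1,2)] assms(3)] core_subset assms(3) by blast

definition critical_triple :: "'a \<Rightarrow> 'a set \<Rightarrow> 'b set \<Rightarrow> 'b set \<Rightarrow> bool" where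
  "critical_triple s X Y T0 \<longleftrightarrow> tight_triple X Y T0 \<and> s \<notin> X \<and> \<not> core s \<subseteq> Y"

lemma critical_triple_not_adjacent:
  assumes "critical_triple s X Y T0" "t \<in> T0"
  shows "(s, t) \<notin> F"
proof
  assume "(s, t) \<in> F"
  then have "spans r (X \<union> \<Gamma> T0) s"
    using assms(2) by (intro spans_member) auto
  then have "blocking s Y"
    using assms(1) unfolding critical_triple_def blocking_def spanning_triple_def by blast
  then show False
    using core_subset assms(1) unfolding critical_triple_def by blast
qed

lemma critical_triple_meets_core:
  assumes "s \<in> S" "sum mT T = g" and critical: "critical_triple s X Y T0"
  shows "T0 \<inter> core s \<noteq> {}"
proof
  assume disjoint: "T0 \<inter> core s = {}"
  have tight: "tight_triple X Y T0" "s \<notin> X"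
    using critical unfolding critical_triple_def by auto
  have "blocking s (core s \<inter> Y)"
    using blocking_core[OF assms(1,2)]
  proof (cases rule: blocking_cases)
    case (pair X')
    then show ?thesis
      using tight_pair_Un_triple_if_disjoint[OF tight(1) pair(2) disjoint] tight(2)
      unfolding blocking_def Int_commute[of "core s"] by blast
  next
    case (triple X' T0')
    then show ?thesis
      using blocking_Int_triple[OF assms(1)] tight by blast
  qed
  then show False
    using core_subset critical unfolding critical_triple_def by blast
qed

lemma unblockedI:
  assumes "t \<in> core s" "\<And>X Y T0. critical_triple s X Y T0 \<Longrightarrow> t \<in> Y \<union> T0"
  shows "unblocked s t"
  using assms core_subset unfolding unblocked_def critical_triple_def by blast

lemma minimal_critical_triple_unblocked:
  assumes critical: "critical_triple s X Y T0" and t: "t \<in> T0 \<inter> core s"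
    and minimal: "\<And>X' Y' T0'. critical_triple s X' Y' T0' \<Longrightarrow> T0' \<subseteq> T0 \<Longrightarrow> T0' = T0"
  shows "unblocked s t"
proof (rule unblockedI)
  show "t \<in> core s"
    using t by blast
  fix X' Y' T0' assume critical': "critical_triple s X' Y' T0'"
  show "t \<in> Y' \<union> T0'"
  proof (rule ccontr)
    assume t': "t \<notin> Y' \<union> T0'"
    have "t \<notin> Y"
      using critical t unfolding critical_triple_def tight_triple_def by blast
    then have "critical_triple s (X \<inter> X') (Y \<union> Y') (T0 \<inter> T0')"
      using tight_triple_uncross(2)[of X Y T0 X' Y' T0'] critical critical' t t'
      unfolding critical_triple_def by blast
    then show False
      using minimal[of "X \<inter> X'" "Y \<union> Y'" "T0 \<inter> T0'"] t t' by blast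
  qed
qed

lemma ex_unblocked_edge:
  assumes s: "s \<in> S" "0 < mS s" and sum_mT: "sum mT T = g"
  obtains t where "t \<in> T" "(s, t) \<notin> F" "0 < mT t" "unblocked s t"
proof -
  have blocking: "blocking s (core s)"
    using blocking_core[OF s(1) sum_mT] .
  have "\<exists>t\<in>core s. (s, t) \<notin> F \<and> unblocked s t"
  proof (cases "\<exists>X Y T0. critical_triple s X Y T0")
    case False
    obtain t where "t \<in> core s" "(s, t) \<notin> F"
      using blocking_contains_nonneighbour[OF s blocking] .
    then show ?thesis
      using unblockedI False by blast
  next
    case True
    define \<T> where "\<T> = {T0. \<exists>X Y. critical_triple s X Y T0}"
    have "\<T> \<subseteq> Pow T"
      unfolding \<T>_def critical_triple_def tight_triple_def by blast
    then have "finite \<T>"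
      using finite_T finite_subset by blast
    moreover have "\<T> \<noteq> {}"
      using True unfolding \<T>_def by blast
    ultimately obtain T0 where T0: "T0 \<in> \<T>" "\<And>T0'. T0' \<in> \<T> \<Longrightarrow> T0' \<subseteq> T0 \<Longrightarrow> T0' = T0"
      using finite_has_minimal[of \<T>] by metis
    obtain X Y where critical: "critical_triple s X Y T0"
      using T0(1) unfolding \<T>_def by blast
    obtain t where t: "t \<in> T0 \<inter> core s"
      using critical_triple_meets_core[OF s(1) sum_mT critical] by blast
    have "unblocked s t"
      using minimal_critical_triple_unblocked[OF critical t] T0(2) unfolding \<T>_def by blast
    then show ?thesis
      using critical_triple_not_adjacent[OF critical] t by blast
  qed
  then show thesis
    using that degree_pos_on_core[OF s(1) sum_mT] blocking_subset[OF blocking] by blast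
qed

lemma unblocked_slack_pos:
  assumes "unblocked s t" "X \<subseteq> S" "Y \<subseteq> T" "s \<notin> X" "t \<notin> Y"
  shows "0 < h X Y"
proof -
  have "h X Y \<noteq> 0"
    using assms unfolding unblocked_def blocking_def tight_pair_def by blast
  then show ?thesis
    using slack_nonneg[OF assms(2,3)] by linarith
qed

lemma unblocked_slack_gt_deficit:
  assumes "unblocked s t" "s \<in> S" "X \<subseteq> S" "Y \<subseteq> T" "s \<notin> X" "t \<notin> Y" "T0 \<subseteq> T - Y"
  shows "p T0 - int (r (X \<union> (insert (s, t) F)\<inverse> `` T0)) < h X Y"
proof (cases "tight_triple X Y T0")
  case True
  then have "t \<in> T0" and not_spans: "\<not> spans r (X \<union> \<Gamma> T0) s"
    using assms unfolding unblocked_def blocking_def spanning_triple_def by blast+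
  then have "X \<union> (insert (s, t) F)\<inverse> `` T0 = insert s (X \<union> \<Gamma> T0)"
    by auto
  moreover have "r (X \<union> \<Gamma> T0) \<le> r (insert s (X \<union> \<Gamma> T0))"
    using assms \<Gamma>_subset by (intro rank_mono) auto
  ultimately show ?thesis
    using True not_spans unfolding tight_triple_def spans_def by auto
next
  case False
  then have "p T0 - int (r (X \<union> \<Gamma> T0)) < h X Y"
    using slack_ge_deficit[OF assms(3,4,7)] assms unfolding tight_triple_def by linarith
  moreover have "r (X \<union> \<Gamma> T0) \<le> r (X \<union> (insert (s, t) F)\<inverse> `` T0)"
    using assms edges by (intro rank_mono) auto
  ultimately show ?thesis
    by linarith
qed

lemma feasible_insert_edge:
  assumes "g = Suc n" and st: "s \<in> S" "(s, t) \<notin> F" "0 < mS s" "0 < mT t"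
    and unblocked: "unblocked s t"
  shows "feasible S T r p (insert (s, t) F) (decrement s mS) (decrement t mT) n"
  unfolding feasible_def
proof (intro conjI allI impI)
  fix X Y assume XY: "X \<subseteq> S" "Y \<subseteq> T"
  have slack: "slack (insert (s, t) F) (decrement s mS) (decrement t mT) n X Y =
      h X Y - of_bool (s \<notin> X \<and> t \<notin> Y)"
    using st finite_left[OF XY(1)] finite_right[OF XY(2)]
    unfolding \<open>g = Suc n\<close> by (intro slack_insert_edge)
  show "0 \<le> slack (insert (s, t) F) (decrement s mS) (decrement t mT) n X Y"
    using unblocked_slack_pos[OF unblocked XY] slack_nonneg[OF XY] unfolding slack by auto
  fix T0 assume T0: "T0 \<subseteq> T - Y"
  have "r (X \<union> \<Gamma> T0) \<le> r (X \<union> (insert (s, t) F)\<inverse> `` T0)"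
    using st XY edges by (intro rank_mono) auto
  then show "p T0 - int (r (X \<union> (insert (s, t) F)\<inverse> `` T0))
      \<le> slack (insert (s, t) F) (decrement s mS) (decrement t mT) n X Y"
    using unblocked_slack_gt_deficit[OF unblocked st(1) XY _ _ T0] slack_ge_deficit[OF XY T0]
    unfolding slack by auto
qed

end

section \<open>Sufficiency\<close>

lemma has_degrees_insert_edge:
  assumes "finite E" "(s, t) \<notin> E" "0 < mS s" "0 < mT t"
    and "has_degrees S T E (decrement s mS) (decrement t mT)"
  shows "has_degrees S T (insert (s, t) E) mS mT"
proof -
  have "insert (s, t) E `` {s'} = (if s' = s then insert t (E `` {s}) else E `` {s'})"
    "(insert (s, t) E)\<inverse> `` {t'} = (if t' = t then insert s (E\<inverse> `` {t}) else E\<inverse> `` {t'})" for s' t'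
    by auto
  moreover have "finite (E `` {s})" "finite (E\<inverse> `` {t})"
    using assms(1) by simp_all
  ultimately show ?thesis
    using assms unfolding has_degrees_def decrement_def by (auto split: if_splits)
qed

lemma realizable_insert_edge:
  assumes "finite S" "finite T" "s \<in> S" "t \<in> T" "(s, t) \<notin> F" "0 < mS s" "0 < mT t"
    and "realizable S T r p (insert (s, t) F) (decrement s mS) (decrement t mT)"
  shows "realizable S T r p F mS mT"
proof -
  obtain E where E: "E \<subseteq> S \<times> T - insert (s, t) F"
      "has_degrees S T E (decrement s mS) (decrement t mT)"
    and cover: "\<And>Y. Y \<subseteq> T \<Longrightarrow> p Y \<le> int (r ((E \<union> insert (s, t) F)\<inverse> `` Y))"
    using assms(8) unfolding realizable_def by blast
  have "finite E"
    using E(1) assms(1,2) by (meson finite_Diff finite_SigmaI finite_subset)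
  then have "has_degrees S T (insert (s, t) E) mS mT"
    using E assms by (intro has_degrees_insert_edge) auto
  moreover have "insert (s, t) E \<subseteq> S \<times> T - F"
    using E assms by auto
  ultimately show ?thesis
    using cover unfolding realizable_def by (intro exI[of _ "insert (s, t) E"]) simp
qed

lemma feasible_imp_realizable:
  assumes M: "matroid S r" and T: "finite T" and "fully_supermodular T p"
    and "F \<subseteq> S \<times> T" "feasible S T r p F mS mT g" "sum mS S = g" "sum mT T = g"
  shows "realizable S T r p F mS mT"
  using assms(4-)
proof (induction g arbitrary: F mS mT)
  case 0
  have "finite S"
    using matroid_finite[OF M] .
  then have "has_degrees S T {} mS mT"
    using 0 T by (simp add: has_degrees_def)
  moreover have "p Y \<le> int (r (F\<inverse> `` Y))" if "Y \<subseteq> T" for Y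
  proof -
    have "p Y - int (r ({} \<union> F\<inverse> `` Y)) \<le> slack F mS mT 0 {} {}"
      using that by (intro feasibleD(2)[OF 0(2)]) auto
    then show ?thesis
      by (simp add: slack_def)
  qed
  ultimately show ?case
    unfolding realizable_def by (intro exI[of _ "{}"]) auto
next
  case (Suc g)
  interpret feasible_instance S T r p F mS mT "Suc g"
    using assms Suc.prems by unfold_locales
  obtain s where s: "s \<in> S" "0 < mS s"
    using Suc.prems(3) by (metis gr0I sum.neutral nat.distinct(1))
  obtain t where t: "t \<in> T" "(s, t) \<notin> F" "0 < mT t" "unblocked s t"
    using ex_unblocked_edge[OF s Suc.prems(4)] .
  have "feasible S T r p (insert (s, t) F) (decrement s mS) (decrement t mT) g"
    using feasible_insert_edge[OF refl s(1) t(2) s(2) t(3,4)] .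
  then have "realizable S T r p (insert (s, t) F) (decrement s mS) (decrement t mT)"
    using s t Suc.prems sum_decrement[of S mS s] sum_decrement[of T mT t] T finite_left
    by (intro Suc.IH) auto
  then show ?case
    using s t T matroid_finite[OF M] by (metis realizable_insert_edge)
qed

section \<open>Edge multisets\<close>

lemma simple_plus_iff:
  "simple (E + F) \<longleftrightarrow> simple E \<and> simple F \<and> set_mset E \<inter> set_mset F = {}"
proof -
  have "m + n \<le> 1 \<longleftrightarrow> m \<le> 1 \<and> n \<le> 1 \<and> \<not> (0 < m \<and> 0 < n)" for m n :: nat
    by auto
  then show ?thesis
    unfolding simple_def disjoint_iff count_union count_greater_zero_iff[symmetric] by metis
qed

lemma simple_mset_set: "simple (mset_set E)"
  unfolding simple_def by (simp add: count_mset_set')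

lemma simple_imp_mset_set_set_mset:
  assumes "simple E"
  shows "mset_set (set_mset E) = E"
proof (rule multiset_eqI)
  fix e
  have "count E e \<le> 1"
    using assms unfolding simple_def by blast
  then show "count (mset_set (set_mset E)) e = count E e"
    by (cases "e \<in># E") (auto simp: le_Suc_eq count_eq_zero_iff)
qed

lemma simple_degree_eq:
  assumes "simple E"
  shows "degree E v = card {e \<in> set_mset E. fst e = v \<or> snd e = v}"
  by (subst simple_imp_mset_set_set_mset[OF assms, symmetric]) (simp add: degree_def)

lemma fits_iff_has_degrees:
  assumes "S \<inter> T = {}" "bigraph S T E" "simple E"
  shows "fits S T E mS mT \<longleftrightarrow> has_degrees S T (set_mset E) mS mT"
proof -
  have "degree E s = card (set_mset E `` {s})" if "s \<in> S" for s
  proof -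
    have "{e \<in> set_mset E. fst e = s \<or> snd e = s} = {s} \<times> set_mset E `` {s}"
      using assms that unfolding bigraph_def by force
    then show ?thesis
      unfolding simple_degree_eq[OF assms(3)] by (simp add: card_cartesian_product)
  qed
  moreover have "degree E t = card ((set_mset E)\<inverse> `` {t})" if "t \<in> T" for t
  proof -
    have "{e \<in> set_mset E. fst e = t \<or> snd e = t} = (set_mset E)\<inverse> `` {t} \<times> {t}"
      using assms that unfolding bigraph_def by force
    then show ?thesis
      unfolding simple_degree_eq[OF assms(3)] by (simp add: card_cartesian_product)
  qed
  ultimately show ?thesis
    unfolding fits_def has_degrees_def by simp
qed

lemma neighbours_eq_Image: "neighbours E Y = (set_mset E)\<inverse> `` Y"
  unfolding neighbours_def by auto

lemma realizable_iff_ex_bigraph: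
  assumes "finite S" "finite T" "S \<inter> T = {}" "simple F"
  shows "realizable S T r p (set_mset F) mS mT \<longleftrightarrow>
    (\<exists>E. bigraph S T E \<and> fits S T E mS mT \<and> simple (E + F) \<and> matroid_covers r T (E + F) p)"
proof
  assume "realizable S T r p (set_mset F) mS mT"
  then obtain E where E: "E \<subseteq> S \<times> T - set_mset F" "has_degrees S T E mS mT"
    "\<forall>Y\<subseteq>T. p Y \<le> int (r ((E \<union> set_mset F)\<inverse> `` Y))"
    unfolding realizable_def by blast
  have "finite E"
    using E(1) assms(1,2) by (meson finite_Diff finite_SigmaI finite_subset)
  then have "bigraph S T (mset_set E)" "simple (mset_set E + F)"
    "matroid_covers r T (mset_set E + F) p"
    using E assms(4)
    by (auto simp: bigraph_def simple_plus_iff simple_mset_set matroid_covers_def neighbours_eq_Image)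
  moreover from this have "fits S T (mset_set E) mS mT"
    using fits_iff_has_degrees[OF assms(3) _ simple_mset_set, of E] E \<open>finite E\<close> by simp
  ultimately show
    "\<exists>E. bigraph S T E \<and> fits S T E mS mT \<and> simple (E + F) \<and> matroid_covers r T (E + F) p"
    by blast
next
  assume "\<exists>E. bigraph S T E \<and> fits S T E mS mT \<and> simple (E + F) \<and> matroid_covers r T (E + F) p"
  then obtain E where E: "bigraph S T E" "fits S T E mS mT" "simple (E + F)"
    "matroid_covers r T (E + F) p"
    by blast
  have "set_mset E \<subseteq> S \<times> T - set_mset F"
    using E(1,3) unfolding bigraph_def simple_plus_iff by blast
  moreover have "has_degrees S T (set_mset E) mS mT"
    using fits_iff_has_degrees[OF assms(3) E(1)] E(2,3) unfolding simple_plus_iff by blast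
  ultimately show "realizable S T r p (set_mset F) mS mT"
    using E(4) unfolding realizable_def matroid_covers_def neighbours_eq_Image
    by (intro exI[of _ "set_mset E"]) simp
qed

lemma edges_between_bip_complement:
  assumes "finite S" "finite T" "X \<subseteq> S" "Y \<subseteq> T"
  shows "edges_between (bip_complement S T F) X Y = card (X \<times> Y - set_mset F)"
proof -
  have "{e \<in> S \<times> T - set_mset F. fst e \<in> X \<and> snd e \<in> Y} = X \<times> Y - set_mset F"
    using assms by auto
  then show ?thesis
    using assms by (simp add: edges_between_def bip_complement_def)
qed

theorem theorem5:
  fixes S T :: "'a set"
    and F\<^sub>0 G\<^sub>0 :: "'a edges"
    and r\<^sub>S :: "'a set \<Rightarrow> nat"
    and p\<^sub>T :: "'a set \<Rightarrow> int"
    and m\<^sub>S m\<^sub>T :: "'a \<Rightarrow> nat"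
    and \<gamma> :: nat
  assumes "finite S" "S \<noteq> {}" "finite T" "T \<noteq> {}" "S \<inter> T = {}"
    and "bigraph S T F\<^sub>0" "simple F\<^sub>0"
    and "G\<^sub>0 = bip_complement S T F\<^sub>0"
    and "matroid S r\<^sub>S"
    and "fully_supermodular T p\<^sub>T"
    and "(\<Sum>s\<in>S. m\<^sub>S s) = \<gamma>" "(\<Sum>t\<in>T. m\<^sub>T t) = \<gamma>"
  shows "(\<exists>E. bigraph S T E \<and> fits S T E m\<^sub>S m\<^sub>T \<and> simple (E + F\<^sub>0)
              \<and> matroid_covers r\<^sub>S T (E + F\<^sub>0) p\<^sub>T)
    \<longleftrightarrow>
      (\<forall>X Y. X \<subseteq> S \<longrightarrow> Y \<subseteq> T \<longrightarrow>
         int (\<Sum>s\<in>X. m\<^sub>S s) + int (\<Sum>t\<in>Y. m\<^sub>T t) - int (edges_between G\<^sub>0 X Y) \<le> int \<gamma>)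
    \<and> (\<forall>X Y T\<^sub>0. X \<subseteq> S \<longrightarrow> Y \<subseteq> T \<longrightarrow> T\<^sub>0 \<subseteq> T - Y \<longrightarrow>
         int (\<Sum>s\<in>X. m\<^sub>S s) + int (\<Sum>t\<in>Y. m\<^sub>T t) - int (edges_between G\<^sub>0 X Y)
           + p\<^sub>T T\<^sub>0 - int (r\<^sub>S (X \<union> neighbours F\<^sub>0 T\<^sub>0)) \<le> int \<gamma>)"
    (is "?L \<longleftrightarrow> ?R")
proof -
  have F: "set_mset F\<^sub>0 \<subseteq> S \<times> T"
    using assms(6) unfolding bigraph_def .
  have slack: "slack (set_mset F\<^sub>0) m\<^sub>S m\<^sub>T \<gamma> X Y =
      int \<gamma> - int (\<Sum>s\<in>X. m\<^sub>S s) - int (\<Sum>t\<in>Y. m\<^sub>T t) + int (edges_between G\<^sub>0 X Y)"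
    if "X \<subseteq> S" "Y \<subseteq> T" for X Y
    using edges_between_bip_complement[OF assms(1,3) that] assms(8) by (simp add: slack_def)
  have "?L \<longleftrightarrow> realizable S T r\<^sub>S p\<^sub>T (set_mset F\<^sub>0) m\<^sub>S m\<^sub>T"
    using realizable_iff_ex_bigraph[OF assms(1,3,5,7)] by blast
  also have "\<dots> \<longleftrightarrow> feasible S T r\<^sub>S p\<^sub>T (set_mset F\<^sub>0) m\<^sub>S m\<^sub>T \<gamma>"
    using realizable_imp_feasible[OF assms(9,3) F assms(11)]
      feasible_imp_realizable[OF assms(9,3,10) F _ assms(11,12)] by blast
  also have "\<dots> \<longleftrightarrow> ?R"
    unfolding feasible_def neighbours_eq_Image
    by (intro arg_cong2[where f = "(\<and>)"] all_cong1 imp_cong refl) (auto simp: slack)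
  finally show ?thesis .
qed

end
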